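(* Let $s$ and $p$ be positive integers, and write $s=kp+r$ with $k\ge 0$ an integer and $0\le r<p$. Then the number of $(s,s+1)$-core partitions $\lambda$ all of whose parts are multiples of $p$ equals the Raney number \[R_{p+1,r+1}(k)=\frac{r+1}{k(p+1)+r+1}\binom{k(p+1)+r+1}{k}.\] Equivalently, this number equals $\frac{s+1-p\lfloor s/p\rfloor}{s+1}\binom{s+\lfloor s/p\rfloor}{s}$.
   Context: A partition $\lambda=(\lambda_1,\dots,\lambda_m)$ is a finite nonincreasing sequence of positive integers (the empty partition is included). In its Young diagram (left- and top-justified rows of $\lambda_i$ boxes), the hook length of a box is the number of boxes consisting of the box itself, the boxes directly to its right, and the boxes directly below it. For a positive integer $t$, $\lambda$ is a $t$-core if no box has hook length divisible by $t$; $\lambda$ is an $(s,t)$-core if it is both an $s$-core and a $t$-core. The Raney numbers are $R_{p,r}(k)=\frac{r}{kp+r}\binom{kp+r}{k}$. *)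

theory Defs
  imports Complex_Main
begin

definition is_partition :: "nat list \<Rightarrow> bool" where
  "is_partition la \<longleftrightarrow> sorted_wrt (\<ge>) la \<and> (\<forall>x\<in>set la. 0 < x)"

definition young_diagram :: "nat list \<Rightarrow> (nat \<times> nat) set" where
  "young_diagram la = {(i, j). i < length la \<and> j < la ! i}"

definition hook_length :: "nat list \<Rightarrow> nat \<times> nat \<Rightarrow> nat" where
  "hook_length la c =
     card ({c} \<union> {(i', j'). i' = fst c \<and> snd c < j' \<and> (i', j') \<in> young_diagram la}
               \<union> {(i', j'). j' = snd c \<and> fst c < i' \<and> (i', j') \<in> young_diagram la})"

definition is_core :: "nat \<Rightarrow> nat list \<Rightarrow> bool" where
  "is_core t la \<longleftrightarrow> (\<forall>c\<in>young_diagram la. \<not> t dvd hook_length la c)"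

definition raney :: "nat \<Rightarrow> nat \<Rightarrow> nat \<Rightarrow> real" where
  "raney p r k = real r / real (k * p + r) * real ((k * p + r) choose k)"

end

theory Submission
  imports Defs
begin

text \<open>
  A partition is determined by its beta set \<open>X\<close> (first-column hook lengths); it is a \<open>t\<close>-core iff
  \<open>X\<close> is closed under subtracting \<open>t\<close>, and its parts are the numbers of non-members below the
  members of \<open>X\<close>. For an \<open>(s,s+1)\<close>-core, \<open>X\<close> is encoded by the heights \<open>h b\<close> of its residue classes
  modulo \<open>s\<close>, which satisfy \<open>h 0 = 0\<close> and \<open>h (b+1) \<le> h b + 1\<close>, that is, by the preorder depth
  sequence of a plane forest with \<open>s\<close> nodes. Listing for each node, in breadth-first order, the
  breadth-first index of its parent gives a weakly increasing sequence \<open>q\<close> with \<open>q j \<le> j\<close>.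
  This map is injective between finite sets of equal size, hence bijective, and all parts are
  divisible by \<open>p\<close> iff all entries of \<open>q\<close> are. Dividing \<open>q\<close> by \<open>p\<close> leaves a ballot problem.
\<close>

section \<open>Ballot sequences\<close>

text \<open>Read entry by entry, \<open>q\<close> is a lattice path kept below a line of slope
  \<open>1/p\<close>. The cap \<open>i\<close> is the second recursion variable of the
  count.\<close>

definition ballot :: "nat \<Rightarrow> nat \<Rightarrow> nat \<Rightarrow> nat list set" where
  "ballot p n i = {q. length q = n \<and> sorted q \<and> (\<forall>j<n. p * q ! j \<le> j) \<and> (\<forall>x\<in>set q. x \<le> i)}"

lemma finite_ballot: "finite (ballot p n i)"
  by (rule finite_subset[OF _ finite_lists_length_eq[of "{..i}" n]]) (auto simp: ballot_def)

lemma ballot_zero: "ballot p n 0 = {replicate n 0}"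
proof -
  have "q = replicate n 0" if "length q = n" "\<forall>x\<in>set q. x = 0" for q :: "nat list"
    using that by (metis replicate_eqI)
  then show ?thesis by (auto simp: ballot_def)
qed

text \<open>Split on the last entry: if it is not \<open>Suc i\<close>, sortedness caps every entry
  at \<open>i\<close>. The hypothesis says exactly that the value \<open>Suc i\<close> is allowed at
  position \<open>n\<close>.\<close>

lemma ballot_snoc:
  assumes "p * Suc i \<le> n"
  shows "ballot p (Suc n) (Suc i) = ballot p (Suc n) i \<union> (\<lambda>q. q @ [Suc i]) ` ballot p n (Suc i)"
proof (intro equalityI subsetI)
  fix q assume q: "q \<in> ballot p (Suc n) (Suc i)"
  then obtain q' x where qx: "q = q' @ [x]" "length q' = n"
    unfolding ballot_def by (auto simp: length_Suc_conv_rev)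
  show "q \<in> ballot p (Suc n) i \<union> (\<lambda>q. q @ [Suc i]) ` ballot p n (Suc i)"
  proof (cases "x = Suc i")
    case True
    have "p * q' ! j \<le> j" if "j < n" for j
    proof -
      have "p * q ! j \<le> j" using q that by (simp add: ballot_def)
      then show ?thesis using qx that by (simp add: nth_append)
    qed
    then have "q' \<in> ballot p n (Suc i)"
      using q qx by (auto simp: ballot_def sorted_append)
    then show ?thesis using qx True by blast
  next
    case False
    then have "x \<le> i" using q qx by (auto simp: ballot_def)
    then have "\<forall>y\<in>set q. y \<le> i" using q qx by (auto simp: ballot_def sorted_append)
    then show ?thesis using q by (auto simp: ballot_def)
  qed
next
  fix q assume "q \<in> ballot p (Suc n) i \<union> (\<lambda>q. q @ [Suc i]) ` ballot p n (Suc i)"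
  then show "q \<in> ballot p (Suc n) (Suc i)"
    using assms by (auto simp: ballot_def sorted_append nth_append less_Suc_eq)
qed

lemma ballot_saturated:
  assumes "n < p * Suc i"
  shows "ballot p (Suc n) (Suc i) = ballot p (Suc n) i"
proof -
  have "x \<le> i" if mem: "q \<in> ballot p (Suc n) (Suc i)" "x \<in> set q" for q x
  proof -
    have q: "length q = Suc n" "\<forall>j<Suc n. p * q ! j \<le> j" using mem(1) by (auto simp: ballot_def)
    obtain j where j: "j < Suc n" "x = q ! j"
      using mem(2) unfolding in_set_conv_nth q(1) by blast
    then have "p * x \<le> j" using q(2) by simp
    then have "p * x \<le> n" using j(1) by simp
    then have "p * x < p * Suc i" using assms by (rule le_less_trans)
    then show ?thesis by (simp only: mult_less_cancel1 less_Suc_eq_le)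
  qed
  then have "ballot p (Suc n) (Suc i) \<subseteq> ballot p (Suc n) i"
    unfolding ballot_def by blast
  moreover have "ballot p (Suc n) i \<subseteq> ballot p (Suc n) (Suc i)"
    unfolding ballot_def using le_SucI by blast
  ultimately show ?thesis by blast
qed

text \<open>The conditional makes the binomial with lower index -1 vanish; truncated subtraction
  would turn it into 1. Integers are used because the value is negative once \<open>p * i\<close>
  exceeds \<open>n + 1\<close>.\<close>

definition ballot_number :: "nat \<Rightarrow> nat \<Rightarrow> nat \<Rightarrow> int" where
  "ballot_number p n i =
     int ((n + i) choose i) - int p * (if i = 0 then 0 else int ((n + i) choose (i - 1)))"

text \<open>Absorption turns the second binomial into a multiple of the first. The product form
  exhibits the zero at \<open>p * i = n + 1\<close> and leads to the Raney number.\<close>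

lemma ballot_number_times:
  "int (Suc n) * ballot_number p n i = (int n + 1 - int (p * i)) * int ((n + i) choose i)"
proof (cases i)
  case (Suc j)
  have "Suc j * (Suc (n + j) choose Suc j) = Suc n * (Suc (n + j) choose j)"
    using binomial_absorb_comp[of "Suc (n + j)" j] Suc_times_binomial_eq[of "n + j" j]
    by (simp add: Suc_diff_le)
  then have "int (Suc n) * int (Suc (n + j) choose j) = int (Suc j) * int (Suc (n + j) choose Suc j)"
    by (metis of_nat_mult)
  then have "int p * (int (Suc n) * int (Suc (n + j) choose j))
      = int p * (int (Suc j) * int (Suc (n + j) choose Suc j))" by simp
  then show ?thesis
    unfolding ballot_number_def Suc by (simp add: algebra_simps del: binomial_Suc_Suc)
qed (simp add: ballot_number_def)

lemma ballot_number_rec: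
  "ballot_number p (Suc n) (Suc i) = ballot_number p n (Suc i) + ballot_number p (Suc n) i"
  by (cases i) (simp_all add: ballot_number_def algebra_simps)

text \<open>Count and formula obey the same Pascal-type recursion, so an induction on
  \<open>n\<close> with an inner one on \<open>i\<close> suffices.\<close>

lemma card_ballot:
  assumes "0 < p" and "p * i \<le> n"
  shows "int (card (ballot p n i)) = ballot_number p n i"
  using assms(2)
proof (induction n arbitrary: i)
  case 0
  then show ?case using assms(1) by (simp add: ballot_zero ballot_number_def)
next
  case (Suc n)
  note outer = Suc.IH
  from Suc.prems show ?case
  proof (induction i)
    case 0
    then show ?case by (simp add: ballot_zero ballot_number_def)
  next
    case (Suc i)
    have IH: "int (card (ballot p (Suc n) i)) = ballot_number p (Suc n) i"
      using Suc by simp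
    show ?case
    proof (cases "p * Suc i \<le> n")
      case True
      have "ballot p (Suc n) i \<inter> (\<lambda>q. q @ [Suc i]) ` ballot p n (Suc i) = {}"
        by (auto simp: ballot_def)
      moreover have "card ((\<lambda>q. q @ [Suc i]) ` ballot p n (Suc i)) = card (ballot p n (Suc i))"
        by (simp add: card_image inj_on_def)
      ultimately show ?thesis
        using outer[OF True] IH
        by (simp add: ballot_snoc[OF True] card_Un_disjoint finite_ballot ballot_number_rec)
    next
      case False
      \<comment> \<open>Only the boundary is left. There no sequence ends in \<open>Suc i\<close>,
        and the matching term of the recursion for \<open>ballot_number\<close> is zero.\<close>
      then have eq: "p * Suc i = Suc n" using Suc.prems by simp
      have "int (Suc n) * ballot_number p n (Suc i) = 0"
        unfolding ballot_number_times eq by simp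
      then have "ballot_number p n (Suc i) = 0" by simp
      then show ?thesis
        using False IH by (simp add: ballot_saturated ballot_number_rec)
    qed
  qed
qed

text \<open>For \<open>s = k * p + r\<close> the factor \<open>s + 1 - p * k\<close> is
  \<open>r + 1\<close>, and \<open>k * (p + 1) + r + 1\<close> is \<open>s + k + 1\<close>;
  absorption then removes the extra 1 from the upper index of the binomial.\<close>

lemma card_ballot_eq_raney:
  assumes "0 < p" and "s = k * p + r"
  shows "real (card (ballot p s k)) = raney (p + 1) (r + 1) k"
    and "raney (p + 1) (r + 1) k = real (r + 1) / real (s + 1) * real ((s + k) choose s)"
proof -
  have "int (Suc s) * int (card (ballot p s k)) = int ((r + 1) * ((s + k) choose k))"
    using ballot_number_times[of s p k] card_ballot[of p k s] assms by (simp add: algebra_simps)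
  then have "Suc s * card (ballot p s k) = (r + 1) * ((s + k) choose k)"
    by (metis of_nat_eq_iff of_nat_mult)
  then have "real (Suc s) * real (card (ballot p s k)) = real (r + 1) * real ((s + k) choose k)"
    by (metis of_nat_mult)
  moreover have sym: "(s + k) choose k = (s + k) choose s"
    using binomial_symmetric[of k "s + k"] by simp
  ultimately have c: "real (card (ballot p s k)) = real (r + 1) / real (s + 1) * real ((s + k) choose s)"
    by (simp add: field_simps)
  have "Suc s * (Suc (s + k) choose k) = Suc (s + k) * ((s + k) choose k)"
    using binomial_absorb_comp[of "Suc (s + k)" k] by (simp add: Suc_diff_le)
  then have "real (Suc s) * real (Suc (s + k) choose k) = real (Suc (s + k)) * real ((s + k) choose s)"
    unfolding sym by (metis of_nat_mult)
  moreover have "k * (p + 1) + (r + 1) = Suc (s + k)" using assms by simp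
  ultimately show d: "raney (p + 1) (r + 1) k = real (r + 1) / real (s + 1) * real ((s + k) choose s)"
    unfolding raney_def by (simp add: field_simps del: binomial_Suc_Suc)
  show "real (card (ballot p s k)) = raney (p + 1) (r + 1) k" using c d by simp
qed

section \<open>Height sequences and the breadth-first encoding\<close>

text \<open>Fixing the values from \<open>s\<close> on makes equality of functions the same as
  equality of the first \<open>s\<close> values, as injectivity and counting require.\<close>

definition heights :: "nat \<Rightarrow> (nat \<Rightarrow> nat) set" where
  "heights s = {h. h 0 = 0 \<and> (\<forall>b. Suc b < s \<longrightarrow> h (Suc b) \<le> Suc (h b)) \<and> (\<forall>b\<ge>s. h b = 0)}"

text \<open>
  The complement of \<open>beads s h\<close> below is generated from these \<open>s\<close> numbers by adding multiples
  of \<open>s\<close>. Reading \<open>h\<close> as the depth sequence of a plane forest in preorder, the natural order on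
  \<open>gens s h\<close> is the breadth-first order of the nodes.
\<close>

definition gens :: "nat \<Rightarrow> (nat \<Rightarrow> nat) \<Rightarrow> nat set" where
  "gens s h = (\<lambda>b. h b * s + b) ` {..<s}"

definition gen :: "nat \<Rightarrow> (nat \<Rightarrow> nat) \<Rightarrow> nat \<Rightarrow> nat" where
  "gen s h i = sorted_list_of_set (gens s h) ! i"

text \<open>
  The breadth-first index, counted from 1, of the parent of the node \<open>v\<close>; it is 0 for a root.
\<close>

definition parent :: "nat \<Rightarrow> (nat \<Rightarrow> nat) \<Rightarrow> nat \<Rightarrow> nat" where
  "parent s h v = card {a \<in> gens s h. a + s < v}"

definition zeta :: "nat \<Rightarrow> (nat \<Rightarrow> nat) \<Rightarrow> nat list" where
  "zeta s h = map (parent s h) (sorted_list_of_set (gens s h))"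

section \<open>Enumeration of the generators\<close>

lemma finite_gens: "finite (gens s h)"
  by (simp add: gens_def)

lemma card_gens: "card (gens s h) = s"
proof -
  have "inj_on (\<lambda>b. h b * s + b) {..<s}"
    by (rule inj_on_inverseI[where g = "\<lambda>x. x mod s"]) simp
  then show ?thesis by (simp add: gens_def card_image)
qed

lemma gens_height: "v \<in> gens s h \<Longrightarrow> h (v mod s) = v div s"
  by (auto simp: gens_def)

lemma gens_ex: "b < s \<Longrightarrow> \<exists>v\<in>gens s h. v mod s = b \<and> v div s = h b"
  by (rule bexI[of _ "h b * s + b"]) (auto simp: gens_def)

lemma set_gens_list: "set (sorted_list_of_set (gens s h)) = gens s h"
  by (simp add: finite_gens)

lemma length_gens_list: "length (sorted_list_of_set (gens s h)) = s"
  by (simp add: card_gens)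

lemma gen_in: "i < s \<Longrightarrow> gen s h i \<in> gens s h"
  unfolding gen_def by (metis set_gens_list length_gens_list nth_mem)

lemma gen_surj: "v \<in> gens s h \<Longrightarrow> \<exists>i<s. v = gen s h i"
  unfolding gen_def by (metis set_gens_list length_gens_list in_set_conv_nth)

lemma gen_less_iff: "i < s \<Longrightarrow> j < s \<Longrightarrow> gen s h i < gen s h j \<longleftrightarrow> i < j"
proof -
  have mono: "gen s h i < gen s h j" if "i < j" "j < s" for i j
    unfolding gen_def
    using strict_sorted_list_of_set[of "gens s h"] that length_gens_list[of s h]
    by (metis sorted_wrt_nth_less)
  then show "i < s \<Longrightarrow> j < s \<Longrightarrow> gen s h i < gen s h j \<longleftrightarrow> i < j"
    by (metis linorder_neqE_nat order_less_asym)
qed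

lemma gen_le_iff: "i < s \<Longrightarrow> j < s \<Longrightarrow> gen s h i \<le> gen s h j \<longleftrightarrow> i \<le> j"
  using gen_less_iff[of j s i h] by (simp add: not_less[symmetric])

text \<open>The indices \<open>j\<close> with \<open>gen s h j + s < gen s h i\<close> form an
  initial segment, so its cardinality acts as a threshold.\<close>

lemma parent_less_iff:
  assumes "i < s" "j < s"
  shows "j < parent s h (gen s h i) \<longleftrightarrow> gen s h j + s < gen s h i"
proof -
  define J where "J = {j. j < s \<and> gen s h j + s < gen s h i}"
  have "{a \<in> gens s h. a + s < gen s h i} = gen s h ` J"
    unfolding J_def using gen_in[of _ s h] gen_surj[of _ s h] by auto
  moreover have "inj_on (gen s h) J"
    unfolding J_def using gen_less_iff[of _ s _ h]
    by (intro inj_onI) (metis (lifting) linorder_neqE_nat mem_Collect_eq order_less_irrefl)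
  ultimately have c: "parent s h (gen s h i) = card J"
    by (simp add: parent_def card_image)
  have fin: "finite J" by (simp add: J_def)
  have down: "j' \<in> J" if "j \<in> J" "j' \<le> j" for j j'
  proof -
    have "gen s h j' \<le> gen s h j" using that by (subst gen_le_iff) (auto simp: J_def)
    then show ?thesis using that by (auto simp: J_def)
  qed
  have "j < card J \<longleftrightarrow> j \<in> J"
  proof
    assume "j \<in> J"
    then have "{..j} \<subseteq> J" using down by blast
    then have "card {..j} \<le> card J" using fin by (rule card_mono[rotated])
    then show "j < card J" by simp
  next
    assume less: "j < card J"
    show "j \<in> J"
    proof (rule ccontr)
      assume "j \<notin> J"
      then have "J \<subseteq> {..<j}" using down by (meson lessThan_iff not_less subsetI)
      then have "card J \<le> j" using card_mono[of "{..<j}" J] by simp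
      then show False using less by simp
    qed
  qed
  then show ?thesis using assms c by (simp add: J_def)
qed

lemma parent_le: assumes "i < s" shows "parent s h (gen s h i) \<le> i"
  using parent_less_iff[OF assms assms, of h] by simp

text \<open>This finds the parent of the node at preorder position \<open>b\<close>: the last
  earlier position of height at most \<open>d\<close>. Since heights rise by at most 1 per step, the
  height there is exactly \<open>d\<close>.\<close>

lemma last_lower_height:
  assumes h: "h \<in> heights s" and b: "b < s" and d: "h b = Suc d"
  obtains b' where "b' < b" "h b' = d" "\<And>c. b' < c \<Longrightarrow> c \<le> b \<Longrightarrow> d < h c"
proof -
  define C where "C = {c. c < b \<and> h c \<le> d}"
  have "b \<noteq> 0" using h d by (cases b) (auto simp: heights_def)
  then have "0 \<in> C" using h by (auto simp: C_def heights_def)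
  moreover have fin: "finite C" by (simp add: C_def)
  ultimately have m: "Max C \<in> C" using Max_in by blast
  have above: "d < h c" if "Max C < c" "c \<le> b" for c
  proof (rule ccontr)
    assume "\<not> d < h c"
    then have "c \<in> C" using that d by (cases "c = b") (auto simp: C_def)
    then show False using Max_ge[OF fin, of c] that by simp
  qed
  have "d < h (Suc (Max C))" using m by (intro above) (auto simp: C_def)
  moreover have "Suc (Max C) < s" using m b by (auto simp: C_def)
  ultimately have "d \<le> h (Max C)" using h unfolding heights_def by fastforce
  then have "h (Max C) = d" using m by (auto simp: C_def)
  then show ?thesis using that above m by (auto simp: C_def)
qed

section \<open>Breadth-first order against preorder\<close>

lemma less_iff_div_mod:
  fixes a v s :: nat
  assumes "0 < s"
  shows "a < v \<longleftrightarrow> a div s < v div s \<or> a div s = v div s \<and> a mod s < v mod s"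
proof -
  have *: "a < v" if "a div s < v div s" for a v :: nat
    using that div_le_mono[of v a s] by (meson not_less)
  have "a < v \<longleftrightarrow> a mod s < v mod s" if "a div s = v div s"
    using that div_mult_mod_eq[of a s] div_mult_mod_eq[of v s]
    by (metis add_less_cancel_left)
  then show ?thesis using *[of a v] *[of v a] by (metis linorder_neqE_nat order_less_asym)
qed

lemma add_less_iff_div_mod:
  fixes a v s :: nat
  assumes "0 < s"
  shows "a + s < v \<longleftrightarrow> Suc (a div s) < v div s \<or> Suc (a div s) = v div s \<and> a mod s < v mod s"
  using less_iff_div_mod[OF assms, of "a + s" v] assms by simp

context
  fixes s :: nat and h :: "nat \<Rightarrow> nat"
  assumes h: "h \<in> heights s"
begin

text \<open>For the node of breadth-first index \<open>i\<close>, these are its depth, its preorder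
  position and its parent index. Nodes count from 0 and parent indices from 1, so the parent of a
  non-root is the node \<open>par i - 1\<close>.\<close>

abbreviation (input) "lev i \<equiv> gen s h i div s"
abbreviation (input) "pos i \<equiv> gen s h i mod s"
abbreviation (input) "par i \<equiv> parent s h (gen s h i)"

lemma last_lower_index:
  assumes i: "i < s" and d: "lev i = Suc d"
  obtains j where "j < par i" "j < s" "lev j = d" "\<And>c. pos j < c \<Longrightarrow> c \<le> pos i \<Longrightarrow> d < h c"
proof -
  have s: "0 < s" using i by simp
  have "h (pos i) = Suc d" using gens_height[OF gen_in[OF i]] d by simp
  then obtain b' where b': "b' < pos i" "h b' = d" "\<And>c. b' < c \<Longrightarrow> c \<le> pos i \<Longrightarrow> d < h c"
    using last_lower_height[OF h, of "pos i"] s by auto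
  have "b' < s" using b'(1) s by (meson mod_less_divisor order_less_trans)
  then obtain j where j: "j < s" "pos j = b'" "lev j = d"
    using gens_ex[of b' s h] gen_surj[of _ s h] b'(2) by metis
  then have "gen s h j + s < gen s h i"
    using add_less_iff_div_mod[OF s] b'(1) d by simp
  then have "j < par i" using parent_less_iff i j by blast
  then show ?thesis using that j b'(3) by metis
qed

text \<open>The node \<open>par i - 1\<close> is the last one lying more than \<open>s\<close> below
  node \<open>i\<close>, so it is at least one level higher up; it does not precede the node from
  \<open>last_lower_index\<close>, so it is exactly one level up. Hence parent indices determine
  levels recursively.\<close>

lemma lev_parent:
  assumes i: "i < s"
  shows "lev i = (if par i = 0 then 0 else Suc (lev (par i - 1)))"
proof (cases "lev i")
  case 0
  have "par i = 0"
  proof (rule ccontr)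
    assume "par i \<noteq> 0"
    then have "gen s h 0 + s < gen s h i" using parent_less_iff[of i s 0 h] i by simp
    then show False using 0 i add_less_iff_div_mod[of s "gen s h 0" "gen s h i"] by simp
  qed
  then show ?thesis using 0 by simp
next
  case (Suc d)
  have s: "0 < s" using i by simp
  obtain j where j: "j < par i" "j < s" "lev j = d" using last_lower_index[OF i Suc] by blast
  have p: "par i - 1 < s" "par i - 1 < par i" using j parent_le[OF i, of h] i by auto
  then have "gen s h (par i - 1) + s < gen s h i" using parent_less_iff i by blast
  then have "lev (par i - 1) \<le> d" using Suc add_less_iff_div_mod[OF s] by fastforce
  moreover have "gen s h j \<le> gen s h (par i - 1)" using j p by (simp add: gen_le_iff)
  then have "d \<le> lev (par i - 1)" using j(3) div_le_mono by metis
  ultimately show ?thesis using Suc j(1) by simp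
qed

text \<open>Strictly between a node and its parent, preorder meets only nodes at least as deep as
  that node. A shallower node \<open>i\<close> therefore precedes \<open>i'\<close> unless it comes
  after the parent of \<open>i'\<close>. This replaces a comparison by one with a smaller sum of
  levels.\<close>

lemma pos_less_iff_parent:
  assumes i: "i < s" "i' < s" and less: "lev i < lev i'"
  shows "pos i < pos i' \<longleftrightarrow> \<not> pos (par i' - 1) < pos i"
proof -
  have s: "0 < s" using i by simp
  obtain d where d: "lev i' = Suc d" using less by (cases "lev i'") auto
  obtain j where j: "j < par i'" "j < s" "lev j = d" "\<And>c. pos j < c \<Longrightarrow> c \<le> pos i' \<Longrightarrow> d < h c"
    using last_lower_index[OF i(2) d] by blast
  define q where "q = par i' - 1"
  have q: "q < s" "q < par i'" "j \<le> q" using j parent_le[OF i(2), of h] i by (auto simp: q_def)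
  have lq: "lev q = d" using lev_parent[OF i(2)] d j(1) by (auto simp: q_def split: if_splits)
  have "gen s h q + s < gen s h i'" using parent_less_iff q i by blast
  then have pq: "pos q < pos i'" using add_less_iff_div_mod[OF s] lq d by simp
  have "gen s h j \<le> gen s h q" using q j by (simp add: gen_le_iff)
  then have jq: "pos j \<le> pos q" using less_iff_div_mod[OF s, of "gen s h q" "gen s h j"] lq j(3)
    by (auto simp: not_less[symmetric])
  have "pos i \<le> pos j" if "pos i < pos i'"
  proof (rule ccontr)
    assume "\<not> pos i \<le> pos j"
    then have "d < h (pos i)" using j(4) that by simp
    then show False using less d gens_height[OF gen_in[OF i(1), of h]] by simp
  qed
  then show ?thesis using pq jq unfolding q_def[symmetric] by linarith
qed

lemma pos_less_iff_same_lev: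
  assumes "i < s" "i' < s" "lev i = lev i'"
  shows "pos i < pos i' \<longleftrightarrow> i < i'"
  using gen_less_iff[of i s i' h] less_iff_div_mod[of s "gen s h i" "gen s h i'"] assms by simp

lemma pos_surj: "b < s \<Longrightarrow> \<exists>i<s. pos i = b"
  using gens_ex[of b s h] gen_surj[of _ s h] by metis

lemma pos_bij: "bij_betw (\<lambda>i. pos i) {..<s} {..<s}"
proof -
  have "(\<lambda>i. pos i) ` {..<s} = {..<s}"
  proof (intro equalityI subsetI)
    fix b assume "b \<in> {..<s}"
    then show "b \<in> (\<lambda>i. pos i) ` {..<s}"
      using pos_surj by fastforce
  next
    fix b assume "b \<in> (\<lambda>i. pos i) ` {..<s}"
    then show "b \<in> {..<s}" by (auto intro!: mod_less_divisor)
  qed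
  then show ?thesis by (simp add: bij_betw_def eq_card_imp_inj_on)
qed

text \<open>Positions fill \<open>{..<s}\<close> bijectively, so each equals its rank and relative
  order alone recovers it.\<close>

lemma pos_eq_card:
  assumes "i < s"
  shows "pos i = card {j. j < s \<and> pos j < pos i}"
proof -
  have "(\<lambda>i. pos i) ` {j. j < s \<and> pos j < pos i} = {..<pos i}"
  proof (intro equalityI subsetI)
    fix b assume b: "b \<in> {..<pos i}"
    then have "b < s" using assms
      by (metis lessThan_iff mod_less_divisor order_less_trans gr_zeroI not_less0)
    then obtain j where "j < s" "pos j = b" using pos_surj by blast
    then show "b \<in> (\<lambda>i. pos i) ` {j. j < s \<and> pos j < pos i}"
      using b by blast
  qed auto
  moreover have "inj_on (\<lambda>i. pos i) {j. j < s \<and> pos j < pos i}"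
    by (rule inj_on_subset[OF bij_betw_imp_inj_on[OF pos_bij]]) auto
  ultimately have "card {..<pos i} = card {j. j < s \<and> pos j < pos i}"
    using card_image by fastforce
  then show ?thesis by simp
qed

end

section \<open>The breadth-first encoding as a bijection onto ballot sequences\<close>

lemma zeta_nth: "i < s \<Longrightarrow> zeta s h ! i = parent s h (gen s h i)"
  using length_gens_list[of s h] by (simp add: zeta_def gen_def)

text \<open>The height sequence is rebuilt in stages: parent indices give levels, levels and parents
  give the relative preorder, ranks give positions, and a position with its level is a value of
  \<open>h\<close>.\<close>

lemma zeta_inj: "inj_on (zeta s) (heights s)"
proof (rule inj_onI)
  fix h k assume h: "h \<in> heights s" and k: "k \<in> heights s" and eq: "zeta s h = zeta s k"
  have par: "parent s h (gen s h i) = parent s k (gen s k i)" if "i < s" for i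
    using that eq zeta_nth by metis
  have lev: "i < s \<Longrightarrow> gen s h i div s = gen s k i div s" for i
  proof (induction i rule: less_induct)
    case (less i)
    show ?case
    proof (cases "parent s h (gen s h i) = 0")
      case True
      then show ?thesis using lev_parent[OF h] lev_parent[OF k] par less.prems by simp
    next
      case False
      then have "parent s h (gen s h i) - 1 < i" using parent_le[OF less.prems, of h] by simp
      then show ?thesis
        using lev_parent[OF h] lev_parent[OF k] par less False by simp
    qed
  qed
  have ord: "gen s h i mod s < gen s h j mod s \<longleftrightarrow> gen s k i mod s < gen s k j mod s"
    if "i < s" "j < s" for i j
    using that
  proof (induction "gen s h i div s + gen s h j div s" arbitrary: i j rule: less_induct)
    case less
    \<comment> \<open>Replacing the deeper node \<open>j'\<close> by its parent lowers the sum of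
      levels by one, so the induction hypothesis applies to the new pair.\<close>
    have step: "gen s h i' mod s < gen s h j' mod s \<longleftrightarrow> gen s k i' mod s < gen s k j' mod s"
      if lt: "gen s h i' div s < gen s h j' div s" and ij: "i' < s" "j' < s"
        and sum: "gen s h i' div s + gen s h j' div s = gen s h i div s + gen s h j div s" for i' j'
    proof -
      define q where "q = parent s h (gen s h j') - 1"
      have q: "q < s" using parent_le[OF ij(2), of h] ij by (simp add: q_def)
      have "gen s h q div s < gen s h j' div s"
        using lev_parent[OF h ij(2)] lt by (auto simp: q_def split: if_splits)
      then have "gen s h q mod s < gen s h i' mod s \<longleftrightarrow> gen s k q mod s < gen s k i' mod s"
        using less.hyps[of q i'] q ij sum by simp
      then show ?thesis
        using pos_less_iff_parent[OF h ij lt] pos_less_iff_parent[OF k ij] lt lev ij par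
        by (simp add: q_def)
    qed
    \<comment> \<open>Distinct nodes have distinct positions, so a comparison can be reversed; this
      reduces the case of a deeper first node to \<open>step\<close>.\<close>
    have flip: "gen s f i mod s < gen s f j mod s \<longleftrightarrow>
        i \<noteq> j \<and> \<not> gen s f j mod s < gen s f i mod s" if "f \<in> heights s" for f
      using pos_bij[OF that] less.prems unfolding bij_betw_def inj_on_def
      by (metis lessThan_iff linorder_neqE_nat order_less_asym)
    consider "gen s h i div s = gen s h j div s" | "gen s h i div s < gen s h j div s"
      | "gen s h j div s < gen s h i div s" by linarith
    then show ?case
    proof cases
      case 1
      then show ?thesis
        using pos_less_iff_same_lev[OF h] pos_less_iff_same_lev[OF k] lev less.prems by simp
    next
      case 2
      then show ?thesis using step less.prems by simp
    next
      case 3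
      then show ?thesis using step[OF 3] less.prems flip[OF h] flip[OF k] by simp
    qed
  qed
  have pos: "gen s h i mod s = gen s k i mod s" if "i < s" for i
  proof -
    have "{j. j < s \<and> gen s h j mod s < gen s h i mod s} = {j. j < s \<and> gen s k j mod s < gen s k i mod s}"
      using ord that by blast
    then show ?thesis using pos_eq_card[OF h that] pos_eq_card[OF k that] by simp
  qed
  show "h = k"
  proof
    fix b
    show "h b = k b"
    proof (cases "b < s")
      case True
      then obtain i where "i < s" "b = gen s h i mod s"
        using pos_surj[OF h] by metis
      then show ?thesis using lev pos gens_height gen_in by metis
    next
      case False
      then show ?thesis using h k by (simp add: heights_def)
    qed
  qed
qed

lemma zeta_in_ballot: "zeta s h \<in> ballot 1 s s"
proof -
  have len: "length (zeta s h) = s" by (simp add: zeta_def card_gens)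
  have "sorted (zeta s h)"
    unfolding zeta_def sorted_map
  proof (rule sorted_wrt_mono_rel[OF _ sorted_sorted_list_of_set])
    fix u v :: nat assume "u \<le> v"
    then have "{a \<in> gens s h. a + s < u} \<subseteq> {a \<in> gens s h. a + s < v}" by auto
    then show "parent s h u \<le> parent s h v"
      unfolding parent_def by (intro card_mono) (simp_all add: finite_gens)
  qed
  moreover have nth: "zeta s h ! j \<le> j" if "j < s" for j
    using that parent_le[of j s h] by (simp add: zeta_nth)
  moreover have "x \<le> s" if "x \<in> set (zeta s h)" for x
    using that nth len by (metis in_set_conv_nth le_trans less_imp_le)
  ultimately show ?thesis using len by (simp add: ballot_def)
qed

text \<open>Subtracting \<open>h\<close> from the identity turns the growth condition into monotonicity.\<close>

lemma bij_betw_heights_ballot: "bij_betw (\<lambda>h. map (\<lambda>b. b - h b) [0..<s]) (heights s) (ballot 1 s s)"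
proof (rule bij_betw_byWitness[where f' = "\<lambda>q b. if b < s then b - q ! b else 0"])
  have le: "b < s \<Longrightarrow> h b \<le> b" if "h \<in> heights s" for h b
  proof (induction b)
    case (Suc b)
    then have "h (Suc b) \<le> Suc (h b)" using that by (simp add: heights_def)
    then show ?case using Suc by simp
  qed (use that in \<open>simp add: heights_def\<close>)
  show "(\<lambda>h. map (\<lambda>b. b - h b) [0..<s]) ` heights s \<subseteq> ballot 1 s s"
  proof (rule image_subsetI)
    fix h assume h: "h \<in> heights s"
    have step: "b - h b \<le> Suc b - h (Suc b)" if "Suc b < s" for b
    proof -
      have "h (Suc b) \<le> Suc (h b)" using h that by (simp add: heights_def)
      then show ?thesis by simp
    qed
    then have "sorted (map (\<lambda>b. b - h b) [0..<s])"
      by (simp add: sorted_iff_nth_Suc)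
    then show "map (\<lambda>b. b - h b) [0..<s] \<in> ballot 1 s s"
      by (auto simp: ballot_def)
  qed
  show "(\<lambda>q b. if b < s then b - q ! b else 0) ` ballot 1 s s \<subseteq> heights s"
  proof (rule image_subsetI)
    fix q assume q: "q \<in> ballot 1 s s"
    have "Suc b - q ! Suc b \<le> Suc (b - q ! b)" if "Suc b < s" for b
    proof -
      have "q ! b \<le> q ! Suc b" using q that by (simp add: ballot_def sorted_iff_nth_Suc)
      moreover have "q ! b \<le> b" using q that by (simp add: ballot_def)
      ultimately show ?thesis by simp
    qed
    then show "(\<lambda>b. if b < s then b - q ! b else 0) \<in> heights s"
      by (simp add: heights_def)
  qed
  show "\<forall>h\<in>heights s. (\<lambda>b. if b < s then b - map (\<lambda>b. b - h b) [0..<s] ! b else 0) = h"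
    using le by (auto simp: heights_def)
  show "\<forall>q\<in>ballot 1 s s. map (\<lambda>b. b - (if b < s then b - q ! b else 0)) [0..<s] = q"
    by (auto intro!: nth_equalityI simp: ballot_def)
qed

lemma bij_betw_zeta: "bij_betw (zeta s) (heights s) (ballot 1 s s)"
proof -
  have "card (zeta s ` heights s) = card (ballot 1 s s)"
    using card_image[OF zeta_inj, of s] bij_betw_same_card[OF bij_betw_heights_ballot, of s] by simp
  moreover have "zeta s ` heights s \<subseteq> ballot 1 s s" using zeta_in_ballot by blast
  ultimately have "zeta s ` heights s = ballot 1 s s"
    by (simp add: card_subset_eq finite_ballot)
  then show ?thesis using zeta_inj by (simp add: bij_betw_def)
qed

lemma card_ballot_multiples:
  assumes "0 < p" and "s = k * p + r" and "r < p"
  shows "card {q \<in> ballot 1 s s. \<forall>x\<in>set q. p dvd x} = card (ballot p s k)"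
proof -
  have "(map ((*) p)) ` ballot p s k = {q \<in> ballot 1 s s. \<forall>x\<in>set q. p dvd x}"
  proof (intro equalityI subsetI)
    fix q assume "q \<in> map ((*) p) ` ballot p s k"
    then obtain q' where q: "q = map ((*) p) q'" "q' \<in> ballot p s k" by blast
    have "sorted q" using q by (auto simp: ballot_def sorted_map intro: sorted_wrt_mono_rel)
    moreover have "x \<le> s" if x: "x \<in> set q" for x
    proof -
      obtain y where "x = p * y" "y \<le> k" using x q by (auto simp: ballot_def)
      then have "x \<le> p * k" by simp
      then show ?thesis using assms(2) by (simp add: mult.commute)
    qed
    ultimately show "q \<in> {q \<in> ballot 1 s s. \<forall>x\<in>set q. p dvd x}"
      using q by (auto simp: ballot_def)
  next
    fix q assume q: "q \<in> {q \<in> ballot 1 s s. \<forall>x\<in>set q. p dvd x}"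
    define q' where "q' = map (\<lambda>x. x div p) q"
    have eq: "q = map ((*) p) q'" using q by (auto simp: q'_def intro!: map_idI[symmetric])
    have len: "length q' = s" using q by (simp add: q'_def ballot_def)
    have nth: "p * q' ! j \<le> j" if "j < s" for j
      using q that len eq by (auto simp: ballot_def dest!: spec[of _ j])
    have "sorted q'"
      using q unfolding q'_def sorted_map
      by (auto simp: ballot_def intro: sorted_wrt_mono_rel[OF div_le_mono])
    moreover have "x \<le> k" if x: "x \<in> set q'" for x
    proof -
      obtain j where "j < s" "x = q' ! j" using x len by (metis in_set_conv_nth)
      then have "p * x < s" using nth by (metis le_less_trans)
      \<comment> \<open>Here \<open>r < p\<close> enters: the last multiple of \<open>p\<close> not
        exceeding \<open>s\<close> is \<open>k * p\<close>, which yields the cap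
        \<open>k\<close>.\<close>
      then have "p * x < p * Suc k" using assms(2,3) by (simp add: mult.commute)
      then show ?thesis by (simp only: mult_less_cancel1 less_Suc_eq_le)
    qed
    ultimately have "q' \<in> ballot p s k" using len nth by (simp add: ballot_def)
    then show "q \<in> map ((*) p) ` ballot p s k" using eq by blast
  qed
  moreover have "inj_on (map ((*) p)) (ballot p s k)"
    using assms(1) by (intro inj_onI) (simp add: inj_map_eq_map inj_def)
  ultimately show ?thesis by (metis card_image)
qed

section \<open>Divisibility of the parts\<close>

text \<open>An abacus with \<open>s\<close> runners, where runner \<open>b\<close> carries
  \<open>h b\<close> beads without holes.\<close>

definition beads :: "nat \<Rightarrow> (nat \<Rightarrow> nat) \<Rightarrow> nat set" where
  "beads s h = {x. x div s < h (x mod s)}"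

text \<open>For a member \<open>x\<close> of a beta set this is the part belonging to
  \<open>x\<close>, as \<open>below_beta\<close> shows.\<close>

definition below :: "nat set \<Rightarrow> nat \<Rightarrow> nat" where
  "below X x = card {g. g < x \<and> g \<notin> X}"

lemma below_zero: "below X 0 = 0"
  by (simp add: below_def)

context
  fixes s :: nat and h :: "nat \<Rightarrow> nat"
  assumes s: "0 < s" and h: "h \<in> heights s"
begin

lemma beads_closed:
  shows "x + s \<in> beads s h \<Longrightarrow> x \<in> beads s h"
    and "Suc (x + s) \<in> beads s h \<Longrightarrow> x \<in> beads s h"
proof -
  show "x + s \<in> beads s h \<Longrightarrow> x \<in> beads s h" using s by (simp add: beads_def)
  assume x: "Suc (x + s) \<in> beads s h"
  have "Suc (x + s) div s = Suc (Suc x div s)" "Suc (x + s) mod s = Suc x mod s"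
    using s div_add_self2[of s "Suc x"] mod_add_self2[of "Suc x" s] by simp_all
  then have less: "Suc (Suc x div s) < h (Suc x mod s)" using x by (simp add: beads_def)
  show "x \<in> beads s h"
  proof (cases "Suc (x mod s) = s")
    \<comment> \<open>Adding 1 wraps around to runner 0, which is empty because
      \<open>h 0 = 0\<close>.\<close>
    case True
    then have "Suc x mod s = 0" by (simp add: mod_Suc)
    then show ?thesis using less h by (simp add: heights_def)
  next
    case False
    then have eq: "Suc x mod s = Suc (x mod s)" "Suc x div s = x div s"
      by (auto simp: mod_Suc div_Suc)
    have "x mod s < s" using s by simp
    then have "h (Suc (x mod s)) \<le> Suc (h (x mod s))" using h False by (simp add: heights_def)
    then show ?thesis using less eq by (simp add: beads_def)
  qed
qed

lemma beads_closed_diff: "x \<in> beads s h \<Longrightarrow> s \<le> x \<Longrightarrow> x - s \<in> beads s h"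
  using beads_closed(1)[of "x - s"] by simp

lemma zero_notin_beads: "0 \<notin> beads s h"
  using h by (simp add: beads_def heights_def)

text \<open>A generator is the first empty place on its runner.\<close>

lemma gens_iff: "v \<in> gens s h \<longleftrightarrow> v \<notin> beads s h \<and> (s \<le> v \<longrightarrow> v - s \<in> beads s h)"
proof -
  have "v \<in> gens s h \<longleftrightarrow> v div s = h (v mod s)"
  proof
    assume "v div s = h (v mod s)"
    then have "h (v mod s) * s + v mod s = v" using div_mult_mod_eq[of v s] by simp
    then show "v \<in> gens s h"
      unfolding gens_def using s by (intro image_eqI[of _ _ "v mod s"]) simp_all
  qed (rule gens_height[symmetric])
  also have "\<dots> \<longleftrightarrow> v \<notin> beads s h \<and> (s \<le> v \<longrightarrow> v - s \<in> beads s h)"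
  proof (cases "s \<le> v")
    case True
    then obtain w where "v = w + s" by (metis le_add_diff_inverse2)
    then show ?thesis using s by (auto simp: beads_def)
  qed (auto simp: beads_def)
  finally show ?thesis .
qed

text \<open>Each non-bead below \<open>v - s\<close> is either a generator, counted by
  \<open>parent s h v\<close>, or a smaller non-bead shifted by \<open>s\<close>. If
  \<open>v - s < s\<close>, the last argument truncates to 0 and its term vanishes.\<close>

lemma below_split:
  assumes "v \<in> gens s h" "s \<le> v"
  shows "below (beads s h) (v - s) = parent s h v + below (beads s h) (v - s - s)"
proof -
  define w where "w = v - s"
  have v: "v = w + s" using assms by (simp add: w_def)
  have "{g. g < w \<and> g \<notin> beads s h}
      = {a \<in> gens s h. a + s < v} \<union> (\<lambda>g. g + s) ` {g. g < w - s \<and> g \<notin> beads s h}"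
    (is "?L = ?A \<union> ?B")
  proof (intro equalityI subsetI)
    fix g assume g: "g \<in> ?L"
    show "g \<in> ?A \<union> ?B"
    proof (cases "g \<in> gens s h")
      case False
      then have "s \<le> g" "g - s \<notin> beads s h" using g gens_iff by auto
      then show ?thesis using g by (auto intro!: image_eqI[of _ _ "g - s"])
    qed (use g v in auto)
  next
    fix g assume "g \<in> ?A \<union> ?B"
    then show "g \<in> ?L" using v beads_closed(1) by (auto simp: gens_iff)
  qed
  moreover have "?A \<inter> ?B = {}" by (auto simp: gens_iff)
  moreover have "card ?B = card {g. g < w - s \<and> g \<notin> beads s h}"
    by (intro card_image) (simp add: inj_on_def)
  ultimately show ?thesis
    unfolding below_def parent_def w_def[symmetric]
    by (simp add: card_Un_disjoint finite_gens)
qed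

text \<open>By \<open>below_split\<close>, each parent index is a difference of two values of
  \<open>below\<close>, taken at beads or at 0. Conversely, induction on the bead \<open>x\<close>
  uses the split if \<open>x + s\<close> is a generator, and otherwise finds an earlier place with
  the same value of \<open>below\<close>.\<close>

lemma dvd_below_iff_dvd_parent:
  "(\<forall>x\<in>beads s h. p dvd below (beads s h) x) \<longleftrightarrow> (\<forall>v\<in>gens s h. p dvd parent s h v)"
proof (intro iffI ballI)
  fix v assume all: "\<forall>x\<in>beads s h. p dvd below (beads s h) x" and v: "v \<in> gens s h"
  show "p dvd parent s h v"
  proof (cases "s \<le> v")
    case True
    then have vs: "v - s \<in> beads s h" using v gens_iff by blast
    then have "p dvd below (beads s h) (v - s - s)"
      using all beads_closed_diff[of "v - s"] below_zero by (cases "s \<le> v - s") auto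
    moreover have "p dvd below (beads s h) (v - s)" using all vs by blast
    ultimately show ?thesis using below_split[OF v True] by (metis dvd_add_left_iff)
  qed (simp add: parent_def)
next
  fix x assume all: "\<forall>v\<in>gens s h. p dvd parent s h v" and "x \<in> beads s h"
  from this(2) show "p dvd below (beads s h) x"
  proof (induction x rule: less_induct)
    case (less x)
    show ?case
    proof (cases "x + s \<in> beads s h")
      case False
      then have v: "x + s \<in> gens s h" using less.prems gens_iff by simp
      have "p dvd below (beads s h) (x - s)"
        using less beads_closed_diff[of x] below_zero s by (cases "s \<le> x") auto
      then show ?thesis using below_split[OF v] all v by simp
    next
      case True
      define U where "U = {a \<in> gens s h. a < x + s}"
      \<comment> \<open>The earlier place is \<open>u - s\<close>, with \<open>u\<close> the last
        generator before \<open>x + s\<close>: no non-bead lies from \<open>u - s\<close> up to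
        \<open>x\<close>. If \<open>u < s\<close>, it truncates to 0.\<close>
      define u where "u = Max U"
      have "0 \<in> U" using s zero_notin_beads gens_iff by (simp add: U_def)
      moreover have fin: "finite U" by (simp add: U_def)
      ultimately have "u \<in> U" unfolding u_def using Max_in by blast
      then have u: "u \<in> gens s h" "u < x + s" by (auto simp: U_def)
      \<comment> \<open>The successor of the largest non-bead between \<open>u - s\<close> and \<open>x\<close>, shifted by \<open>s\<close>, would be a generator exceeding \<open>u\<close>.\<close>
      have none: "g + s < u" if g: "g < x" "g \<notin> beads s h" for g
      proof -
        define Z where "Z = {g. g < x \<and> g \<notin> beads s h}"
        define z where "z = Max Z"
        have "finite Z" by (simp add: Z_def)
        moreover have "g \<in> Z" using g by (simp add: Z_def)
        ultimately have z: "z \<in> Z" "g \<le> z" "\<And>y. y \<in> Z \<Longrightarrow> y \<le> z"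
          unfolding z_def using Max_in by auto
        then have "Suc z \<in> beads s h"
          using less.prems Suc_lessI[of z x] by (fastforce simp: Z_def)
        moreover have "Suc z + s \<notin> beads s h" using z(1) beads_closed(2)[of z] by (auto simp: Z_def)
        ultimately have "Suc z + s \<in> gens s h" "Suc z \<noteq> x" using gens_iff[of "Suc z + s"] True by auto
        then have "Suc z + s \<in> U" using z(1) by (auto simp: U_def Z_def)
        then have "Suc z + s \<le> u" unfolding u_def using fin by simp
        then show ?thesis using z(2) by simp
      qed
      then have "{g. g < x \<and> g \<notin> beads s h} = {g. g < u - s \<and> g \<notin> beads s h}"
        using u(2) less_diff_conv by fastforce
      then have eq: "below (beads s h) x = below (beads s h) (u - s)" by (simp add: below_def)
      show ?thesis
      proof (cases "s \<le> u")
        case True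
        then have "u - s \<in> beads s h" "u - s < x" using u gens_iff by auto
        then show ?thesis using less.IH eq by simp
      qed (simp add: eq below_zero)
    qed
  qed
qed

end

lemma card_heights_dvd_below:
  assumes "0 < s" "0 < p" and "s = k * p + r" and "r < p"
  shows "card {h \<in> heights s. \<forall>x\<in>beads s h. p dvd below (beads s h) x} = card (ballot p s k)"
proof -
  let ?H = "{h \<in> heights s. \<forall>x\<in>beads s h. p dvd below (beads s h) x}"
  have dvd: "(\<forall>x\<in>beads s h. p dvd below (beads s h) x) \<longleftrightarrow> (\<forall>x\<in>set (zeta s h). p dvd x)"
    if "h \<in> heights s" for h
    using dvd_below_iff_dvd_parent[OF assms(1) that, of p] by (simp add: zeta_def finite_gens)
  have im: "zeta s ` ?H = {q \<in> ballot 1 s s. \<forall>x\<in>set q. p dvd x}"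
    unfolding bij_betw_imp_surj_on[OF bij_betw_zeta[of s], symmetric] using dvd by auto
  have "inj_on (zeta s) ?H" by (rule inj_on_subset[OF zeta_inj]) blast
  then show ?thesis
    using card_ballot_multiples[OF assms(2-4)] card_image[of "zeta s" ?H] unfolding im by argo
qed

section \<open>Beta sets\<close>

definition beta :: "nat list \<Rightarrow> nat \<Rightarrow> nat" where
  "beta la i = la ! i + (length la - 1 - i)"

definition beta_set :: "nat list \<Rightarrow> nat set" where
  "beta_set la = beta la ` {..<length la}"

definition column_length :: "nat list \<Rightarrow> nat \<Rightarrow> nat" where
  "column_length la j = card {i. i < length la \<and> j < la ! i}"

lemma partition_antimono:
  assumes "is_partition la" "i \<le> j" "j < length la"
  shows "la ! j \<le> la ! i"
  using assms by (cases "i = j") (auto simp: is_partition_def sorted_wrt_iff_nth_less)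

lemma beta_less:
  assumes "is_partition la" "i < j" "j < length la"
  shows "beta la j < beta la i"
  using partition_antimono[OF assms(1), of i j] assms by (simp add: beta_def)

lemma beta_inj: "is_partition la \<Longrightarrow> inj_on (beta la) {..<length la}"
  by (rule inj_onI) (metis beta_less lessThan_iff linorder_neqE_nat order_less_irrefl)

lemma finite_beta_set: "finite (beta_set la)"
  by (simp add: beta_set_def)

lemma card_beta_set: "is_partition la \<Longrightarrow> card (beta_set la) = length la"
  by (simp add: beta_set_def card_image beta_inj)

text \<open>Parts decrease weakly, so the rows reaching past column \<open>j\<close> are the first
  \<open>column_length la j\<close> ones.\<close>

lemma less_column_iff:
  assumes "is_partition la" "i < length la"
  shows "j < la ! i \<longleftrightarrow> i < column_length la j"
proof -
  let ?I = "{i. i < length la \<and> j < la ! i}"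
  have fin: "finite ?I" by simp
  show ?thesis
  proof
    assume "j < la ! i"
    then have "{..i} \<subseteq> ?I" using partition_antimono[OF assms(1)] assms(2) by fastforce
    then have "card {..i} \<le> card ?I" by (rule card_mono[OF fin])
    then show "i < column_length la j" by (simp add: column_length_def)
  next
    assume less: "i < column_length la j"
    show "j < la ! i"
    proof (rule ccontr)
      assume "\<not> j < la ! i"
      then have "?I \<subseteq> {..<i}"
        using partition_antimono[OF assms(1), of i] by (fastforce simp: not_less[symmetric])
      then have "card ?I \<le> i" using card_mono[of "{..<i}" ?I] by simp
      then show False using less by (simp add: column_length_def)
    qed
  qed
qed

lemma column_length_le: "column_length la j \<le> length la"
proof -
  have "card {i. i < length la \<and> j < la ! i} \<le> card {..<length la}"
    by (rule card_mono) auto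
  then show ?thesis by (simp add: column_length_def)
qed

text \<open>The \<open>j\<close>-th column contributes the \<open>j\<close>-th natural number outside the beta set.\<close>

definition gap :: "nat list \<Rightarrow> nat \<Rightarrow> nat" where
  "gap la j = j + (length la - column_length la j)"

text \<open>As integers, \<open>beta la i - gap la j\<close> is the sum of \<open>la ! i - j\<close>
  and \<open>column_length la j - i - 1\<close>. By \<open>less_column_iff\<close> the first is
  positive exactly when the second is nonnegative, so the sum is never zero.\<close>

lemma gap_less_beta_iff:
  assumes "is_partition la" "i < length la"
  shows "gap la j < beta la i \<longleftrightarrow> j < la ! i" and "gap la j \<noteq> beta la i"
  using less_column_iff[OF assms, of j] column_length_le[of la j] assms(2)
  by (auto simp: gap_def beta_def)

lemma gap_surj:
  assumes la: "is_partition la" and g: "g \<notin> beta_set la"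
  obtains j where "g = gap la j"
proof -
  let ?m = "length la"
  let ?I = "{i. i < ?m \<and> g < beta la i}"
  define c where "c = card ?I"
  have I: "i < c \<longleftrightarrow> g < beta la i" if i: "i < ?m" for i
  proof
    assume gi: "g < beta la i"
    have "{..i} \<subseteq> ?I"
    proof
      fix i' assume "i' \<in> {..i}"
      then show "i' \<in> ?I" using beta_less[OF la, of i' i] i gi by (cases "i' = i") auto
    qed
    then have "card {..i} \<le> c" unfolding c_def by (intro card_mono) auto
    then show "i < c" by simp
  next
    assume less: "i < c"
    show "g < beta la i"
    proof (rule ccontr)
      assume n: "\<not> g < beta la i"
      have "?I \<subseteq> {..<i}"
      proof
        fix i' assume i': "i' \<in> ?I"
        then have "\<not> i \<le> i'" using beta_less[OF la, of i i'] n by (cases "i' = i") auto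
        then show "i' \<in> {..<i}" by simp
      qed
      then have "c \<le> i" unfolding c_def using card_mono[of "{..<i}" ?I] by simp
      then show False using less by simp
    qed
  qed
  have cm: "c \<le> ?m" unfolding c_def using card_mono[of "{..<?m}" ?I] by auto
  \<comment> \<open>The rows from \<open>c\<close> on have distinct beta numbers below
    \<open>g\<close>, whence \<open>?m - c <= g\<close> and the subtraction defining
    \<open>j\<close> is exact. Thus \<open>j\<close> counts the non-members below \<open>g\<close>,
    and column \<open>j\<close> turns out to have length \<open>c\<close>.\<close>
  have "beta la ` {c..<?m} \<subseteq> {..<g}"
  proof
    fix x assume "x \<in> beta la ` {c..<?m}"
    then obtain i where i: "x = beta la i" "c \<le> i" "i < ?m" by auto
    then have "\<not> g < x" using I[of i] by simp
    moreover have "x \<noteq> g" using g i by (auto simp: beta_set_def)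
    ultimately show "x \<in> {..<g}" by simp
  qed
  then have "card (beta la ` {c..<?m}) \<le> g" using card_mono[of "{..<g}"] by fastforce
  moreover have "inj_on (beta la) {c..<?m}" by (rule inj_on_subset[OF beta_inj[OF la]]) auto
  ultimately have mc: "?m - c \<le> g" by (simp add: card_image)
  define j where "j = g - (?m - c)"
  have lt: "j < la ! i \<longleftrightarrow> i < c" if i: "i < ?m" for i
  proof
    assume ic: "i < c"
    have "g < beta la (c - 1)" using I[of "c - 1"] ic cm by simp
    then have "j < la ! (c - 1)" using ic cm mc by (simp add: beta_def j_def)
    moreover have "la ! (c - 1) \<le> la ! i" using ic cm by (intro partition_antimono[OF la]) auto
    ultimately show "j < la ! i" by simp
  next
    assume ji: "j < la ! i"
    show "i < c"
    proof (rule ccontr)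
      assume ci: "\<not> i < c"
      then have "c < ?m" using i by simp
      then have "\<not> g < beta la c" "g \<noteq> beta la c" using I[of c] g by (auto simp: beta_set_def)
      then have "la ! c \<le> j" using \<open>c < ?m\<close> mc by (simp add: beta_def j_def)
      then show False using partition_antimono[OF la, of c i] ci i ji by simp
    qed
  qed
  have "{i. i < ?m \<and> j < la ! i} = {..<c}" using lt cm by auto
  then have "column_length la j = c" by (simp add: column_length_def)
  then have "g = gap la j" using mc by (simp add: gap_def j_def)
  then show ?thesis by (rule that)
qed

text \<open>The box with its arm contributes \<open>la ! i - j\<close> and the leg
  \<open>column_length la j - i - 1\<close>; these add up to the difference of beta number and
  gap.\<close>

lemma hook_length_eq:
  assumes la: "is_partition la" and c: "(i, j) \<in> young_diagram la"
  shows "hook_length la (i, j) = beta la i - gap la j"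
proof -
  have ij: "i < length la" "j < la ! i" using c by (auto simp: young_diagram_def)
  then have i: "i < column_length la j" using less_column_iff[OF la] by blast
  have "{(i', j'). i' = i \<and> j < j' \<and> (i', j') \<in> young_diagram la} = Pair i ` {j<..<la ! i}"
    using ij by (auto simp: young_diagram_def)
  moreover have "{(i', j'). j' = j \<and> i < i' \<and> (i', j') \<in> young_diagram la}
      = (\<lambda>i'. (i', j)) ` {i<..<column_length la j}"
    using less_column_iff[OF la] column_length_le[of la j] by (auto simp: young_diagram_def)
  ultimately have "hook_length la (i, j)
      = card ({(i, j)} \<union> Pair i ` {j<..<la ! i} \<union> (\<lambda>i'. (i', j)) ` {i<..<column_length la j})"
    by (simp add: hook_length_def)
  also have "\<dots> = card ({(i, j)} \<union> Pair i ` {j<..<la ! i}) + card ((\<lambda>i'. (i', j)) ` {i<..<column_length la j})"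
    by (intro card_Un_disjoint) auto
  also have "card ((\<lambda>i'. (i', j)) ` {i<..<column_length la j}) = column_length la j - i - 1"
    by (simp add: card_image inj_on_def)
  also have "card ({(i, j)} \<union> Pair i ` {j<..<la ! i}) = la ! i - j"
    using ij by (subst card_Un_disjoint) (auto simp: card_image inj_on_def)
  finally show ?thesis
    using ij i column_length_le[of la j] by (simp add: beta_def gap_def)
qed

text \<open>If \<open>x - t\<close> leaves the beta set it is a gap, and the corresponding box has
  hook length exactly \<open>t\<close>. Conversely, a hook length \<open>t * n\<close> would let
  \<open>n\<close> subtractions lead from a beta number to a gap.\<close>

lemma is_core_iff:
  assumes la: "is_partition la" and t: "0 < t"
  shows "is_core t la \<longleftrightarrow> (\<forall>x\<in>beta_set la. t \<le> x \<longrightarrow> x - t \<in> beta_set la)"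
proof
  assume core: "is_core t la"
  show "\<forall>x\<in>beta_set la. t \<le> x \<longrightarrow> x - t \<in> beta_set la"
  proof (intro ballI impI, rule ccontr)
    fix x assume x: "x \<in> beta_set la" "t \<le> x" and n: "x - t \<notin> beta_set la"
    obtain i where i: "i < length la" "x = beta la i" using x by (auto simp: beta_set_def)
    obtain j where j: "x - t = gap la j" using gap_surj[OF la n] by blast
    have "gap la j < beta la i" using i j x t by simp
    then have c: "(i, j) \<in> young_diagram la"
      using gap_less_beta_iff(1)[OF la i(1)] i by (simp add: young_diagram_def)
    have "hook_length la (i, j) = t" using hook_length_eq[OF la c] i j x by simp
    then show False using core c by (auto simp: is_core_def)
  qed
next
  assume closed: "\<forall>x\<in>beta_set la. t \<le> x \<longrightarrow> x - t \<in> beta_set la"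
  have mult: "x \<in> beta_set la \<Longrightarrow> t * n \<le> x \<Longrightarrow> x - t * n \<in> beta_set la" for x n
  proof (induction n)
    case (Suc n)
    then have "x - t * n \<in> beta_set la" "t \<le> x - t * n" by auto
    then have "x - t * n - t \<in> beta_set la" using closed by blast
    then show ?case by (simp add: algebra_simps)
  qed simp
  show "is_core t la"
    unfolding is_core_def
  proof (intro ballI notI)
    fix c assume c: "c \<in> young_diagram la" and dvd: "t dvd hook_length la c"
    obtain i j where ij: "c = (i, j)" "i < length la" "j < la ! i"
      using c by (auto simp: young_diagram_def)
    have less: "gap la j < beta la i" using gap_less_beta_iff(1)[OF la ij(2)] ij(3) by blast
    have "t dvd beta la i - gap la j" using dvd hook_length_eq[OF la] c ij(1) by simp
    then obtain n where n: "beta la i - gap la j = t * n" by (rule dvdE)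
    have "beta la i - t * n \<in> beta_set la"
      using ij n by (intro mult) (auto simp: beta_set_def)
    moreover have "beta la i - t * n = gap la j" using n less by simp
    ultimately show False using gap_less_beta_iff(2)[OF la] by (auto simp: beta_set_def)
  qed
qed

text \<open>Exactly the \<open>length la - 1 - i\<close> later rows have smaller beta numbers;
  removing them from the numbers below \<open>beta la i\<close> leaves
  \<open>la ! i\<close>.\<close>

lemma below_beta:
  assumes la: "is_partition la" and i: "i < length la"
  shows "below (beta_set la) (beta la i) = la ! i"
proof -
  have "{x. x < beta la i \<and> x \<in> beta_set la} = beta la ` {i<..<length la}"
  proof (intro equalityI subsetI)
    fix x assume "x \<in> {x. x < beta la i \<and> x \<in> beta_set la}"
    then obtain i' where "i' < length la" "x = beta la i'" "beta la i' < beta la i"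
      by (auto simp: beta_set_def)
    then show "x \<in> beta la ` {i<..<length la}"
      using beta_less[OF la, of i' i] i
      by (metis greaterThanLessThan_iff imageI linorder_neqE_nat order_less_asym order_less_irrefl)
  qed (use beta_less[OF la, of i] in \<open>auto simp: beta_set_def\<close>)
  moreover have "inj_on (beta la) {i<..<length la}"
    by (rule inj_on_subset[OF beta_inj[OF la]]) auto
  ultimately have c: "card {x. x < beta la i \<and> x \<in> beta_set la} = length la - 1 - i"
    by (simp add: card_image)
  have "{g. g < beta la i \<and> g \<notin> beta_set la} = {..<beta la i} - {x. x < beta la i \<and> x \<in> beta_set la}"
    by auto
  then have "below (beta_set la) (beta la i)
      = card {..<beta la i} - card {x. x < beta la i \<and> x \<in> beta_set la}"
    unfolding below_def by (simp only:) (rule card_Diff_subset, auto)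
  then have "below (beta_set la) (beta la i) = beta la i - (length la - 1 - i)"
    unfolding c by simp
  then show ?thesis by (simp add: beta_def)
qed

lemma zero_notin_beta_set: "is_partition la \<Longrightarrow> 0 \<notin> beta_set la"
  by (auto simp: beta_set_def beta_def is_partition_def all_set_conv_all_nth)

lemma beta_set_inj: "inj_on beta_set {la. is_partition la}"
proof (rule inj_onI)
  have list: "map (beta la) (rev [0..<length la]) = sorted_list_of_set (beta_set la)"
    if "is_partition la" for la
  proof -
    have "sorted_wrt (<) (map (beta la) (rev [0..<length la]))"
      using beta_less[OF that] by (auto simp: sorted_wrt_iff_nth_less rev_nth)
    moreover have "set (map (beta la) (rev [0..<length la])) = set (sorted_list_of_set (beta_set la))"
      by (simp add: finite_beta_set) (auto simp: beta_set_def)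
    ultimately show ?thesis
      by (intro strict_sorted_equal[OF strict_sorted_list_of_set])
  qed
  fix la mu assume la: "la \<in> {la. is_partition la}" and mu: "mu \<in> {la. is_partition la}"
    and eq: "beta_set la = beta_set mu"
  have len: "length la = length mu" using card_beta_set la mu eq by (metis mem_Collect_eq)
  have "map (beta la) (rev [0..<length la]) = map (beta mu) (rev [0..<length la])"
    using list[of la] list[of mu] la mu by (simp add: eq len)
  then have b: "beta la i = beta mu i" if "i < length la" for i using that by simp
  have "la ! i = mu ! i" if "i < length la" for i
    using below_beta la mu that b eq len by (metis mem_Collect_eq)
  then show "la = mu" using len by (intro nth_equalityI)
qed

text \<open>List \<open>X\<close> in decreasing order and subtract the staircase.\<close>

lemma beta_set_surj:
  assumes "finite X" "0 \<notin> X"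
  obtains la where "is_partition la" "beta_set la = X"
proof -
  define bs where "bs = rev (sorted_list_of_set X)"
  define la where "la = map (\<lambda>i. bs ! i - (length bs - 1 - i)) [0..<length bs]"
  have set: "set bs = X" using assms by (simp add: bs_def)
  have "sorted_wrt (>) bs" by (simp add: bs_def sorted_wrt_rev)
  then have step: "bs ! j < bs ! i" if "i < j" "j < length bs" for i j
    using that by (simp add: sorted_wrt_iff_nth_less)
  have drop: "bs ! j + (j - i) \<le> bs ! i" if "i \<le> j" "j < length bs" for i j
    using that
  proof (induction j)
    case (Suc j)
    show ?case
    proof (cases "i = Suc j")
      case False
      then have "bs ! j + (j - i) \<le> bs ! i" using Suc by simp
      then show ?thesis using step[of j "Suc j"] Suc.prems False by (simp add: Suc_diff_le)
    qed simp
  qed simp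
  \<comment> \<open>The last entry is positive because \<open>0\<close> is not in \<open>X\<close>,
    and entries drop by at least 1 per step. So the subtraction in \<open>la\<close> is exact and
    leaves positive parts.\<close>
  have pos: "length bs - 1 - i < bs ! i" if "i < length bs" for i
  proof -
    have "bs ! (length bs - 1) \<in> X" using that set nth_mem[of "length bs - 1" bs] by simp
    then have "0 < bs ! (length bs - 1)" using assms(2) by (metis gr0I)
    moreover have "bs ! (length bs - 1) + (length bs - 1 - i) \<le> bs ! i"
      using drop[of i "length bs - 1"] that by simp
    ultimately show ?thesis by simp
  qed
  have len: "length la = length bs" by (simp add: la_def)
  have "is_partition la"
    unfolding is_partition_def
  proof
    show "sorted_wrt (\<ge>) la"
      unfolding sorted_wrt_iff_nth_less
    proof (intro allI impI)
      fix i j assume ij: "i < j" "j < length la"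
      then show "la ! j \<le> la ! i" using drop[of i j] len by (simp add: la_def)
    qed
    show "\<forall>x\<in>set la. 0 < x" using pos by (fastforce simp: la_def)
  qed
  moreover have "beta la i = bs ! i" if "i < length bs" for i
    using pos[OF that] that by (simp add: beta_def la_def)
  then have "beta_set la = (\<lambda>i. bs ! i) ` {..<length bs}" unfolding beta_set_def len by auto
  then have "beta_set la = X" using set by (auto simp: set_conv_nth)
  ultimately show ?thesis by (rule that)
qed

section \<open>Passage from core partitions to height sequences\<close>

lemma beads_inj: "0 < s \<Longrightarrow> inj_on (beads s) (heights s)"
proof (rule inj_onI)
  fix h k assume s: "0 < s" and h: "h \<in> heights s" and k: "k \<in> heights s" and eq: "beads s h = beads s k"
  have iff: "a * s + b \<in> beads s f \<longleftrightarrow> a < f b" if "b < s" for a b f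
    using that s by (simp add: beads_def)
  have "h b = k b" if "b < s" for b
    using iff[OF that, of _ h] iff[OF that, of _ k] eq by (metis linorder_neqE_nat order_less_irrefl)
  moreover have "h b = k b" if "\<not> b < s" for b using h k that by (simp add: heights_def)
  ultimately show "h = k" by blast
qed

text \<open>Take for \<open>h b\<close> the first empty row on runner \<open>b\<close>. Closure
  under subtracting \<open>s\<close> leaves no bead beyond it, and closure under subtracting
  \<open>s + 1\<close> bounds the growth of \<open>h\<close>.\<close>

lemma beads_surj:
  assumes s: "0 < s" and fin: "finite X" and z: "0 \<notin> X"
    and closed: "\<forall>x\<in>X. s \<le> x \<longrightarrow> x - s \<in> X" "\<forall>x\<in>X. s + 1 \<le> x \<longrightarrow> x - (s + 1) \<in> X"
  obtains h where "h \<in> heights s" "beads s h = X"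
proof -
  define h where "h b = (if b < s then LEAST n. n * s + b \<notin> X else 0)" for b
  have ex: "\<exists>n. n * s + b \<notin> X" for b
  proof (rule ccontr)
    assume "\<not> ?thesis"
    then have "range (\<lambda>n. n * s + b) \<subseteq> X" by auto
    moreover have "inj (\<lambda>n. n * s + b)" using s by (simp add: inj_def)
    ultimately show False using fin by (meson finite_imageD finite_subset infinite_UNIV_nat)
  qed
  have notin: "h b * s + b \<notin> X" if "b < s" for b
    using LeastI_ex[OF ex] that by (simp add: h_def)
  have up: "n * s + b \<notin> X" if "h b \<le> n" "b < s" for n b
    using that(1)
  proof (induction n rule: dec_induct)
    case base
    then show ?case using notin that by simp
  next
    case (step n)
    then show ?case using closed(1) by (fastforce simp: algebra_simps)
  qed
  have iff: "n * s + b \<in> X \<longleftrightarrow> n < h b" if "b < s" for n b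
  proof
    assume "n * s + b \<in> X"
    then show "n < h b" using up that by (meson not_less)
  next
    assume "n < h b"
    then show "n * s + b \<in> X" using not_less_Least[of n "\<lambda>n. n * s + b \<notin> X"] that by (simp add: h_def)
  qed
  have "h \<in> heights s"
    unfolding heights_def
  proof (intro CollectI conjI allI impI)
    show "h 0 = 0" using iff[OF s, of 0] z by simp
    show "h b = 0" if "s \<le> b" for b using that by (simp add: h_def)
    show "h (Suc b) \<le> Suc (h b)" if b: "Suc b < s" for b
    proof (rule ccontr)
      assume "\<not> ?thesis"
      \<comment> \<open>A jump by more than 1 puts a bead in row \<open>Suc (h b)\<close> of runner
        \<open>Suc b\<close>; subtracting \<open>s + 1\<close> lands in row \<open>h b\<close> of
        runner \<open>b\<close>, which is empty.\<close>
      then have "Suc (h b) * s + Suc b \<in> X" by (subst iff[OF b]) simp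
      then have "Suc (h b) * s + Suc b - (s + 1) \<in> X" by (rule closed(2)[rule_format]) simp
      then show False using iff[of b "h b"] b by simp
    qed
  qed
  moreover have "beads s h = X"
  proof (intro set_eqI)
    fix x
    show "x \<in> beads s h \<longleftrightarrow> x \<in> X"
      using iff[of "x mod s" "x div s"] s by (simp add: beads_def)
  qed
  ultimately show ?thesis by (rule that)
qed

lemma finite_beads: "0 < s \<Longrightarrow> finite (beads s h)"
proof -
  assume s: "0 < s"
  have "beads s h \<subseteq> (\<Union>b<s. (\<lambda>n. n * s + b) ` {..<h b})"
  proof
    fix x assume "x \<in> beads s h"
    then have "x = x div s * s + x mod s" "x div s < h (x mod s)" "x mod s < s"
      using s by (simp_all add: beads_def)
    then show "x \<in> (\<Union>b<s. (\<lambda>n. n * s + b) ` {..<h b})" by blast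
  qed
  then show ?thesis by (rule finite_subset) simp
qed

text \<open>Partitions and height sequences are compared through the finite sets they encode:
  \<open>beta_set\<close> and \<open>beads s\<close> are injective and have the same image
  here.\<close>

lemma card_core_partitions:
  assumes s: "0 < s"
  shows "card {la. is_partition la \<and> is_core s la \<and> is_core (s + 1) la \<and> (\<forall>x\<in>set la. p dvd x)}
    = card {h \<in> heights s. \<forall>x\<in>beads s h. p dvd below (beads s h) x}" (is "card ?P = card ?H")
proof -
  have dvd: "(\<forall>x\<in>set la. p dvd x) \<longleftrightarrow> (\<forall>x\<in>beta_set la. p dvd below (beta_set la) x)"
    if "is_partition la" for la
    using below_beta[OF that] by (auto simp: beta_set_def all_set_conv_all_nth)
  have "beta_set ` ?P = beads s ` ?H"
  proof (intro equalityI subsetI)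
    fix X assume "X \<in> beta_set ` ?P"
    then obtain la where la: "X = beta_set la" "is_partition la" "is_core s la" "is_core (s + 1) la"
      "\<forall>x\<in>set la. p dvd x" by blast
    have closed: "\<forall>x\<in>X. s \<le> x \<longrightarrow> x - s \<in> X" "\<forall>x\<in>X. s + 1 \<le> x \<longrightarrow> x - (s + 1) \<in> X"
      using la(1,3,4) is_core_iff[OF la(2), of s] is_core_iff[OF la(2), of "s + 1"] s by simp_all
    have fin: "finite X" "0 \<notin> X"
      using finite_beta_set zero_notin_beta_set[OF la(2)] la(1) by simp_all
    obtain h where h: "h \<in> heights s" "beads s h = X"
      by (rule beads_surj[OF s fin closed])
    have "\<forall>x\<in>X. p dvd below X x" using la(1,5) dvd[OF la(2)] by simp
    then show "X \<in> beads s ` ?H" using h by (intro image_eqI[of _ _ h]) simp_all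
  next
    fix X assume "X \<in> beads s ` ?H"
    then obtain h where h: "X = beads s h" "h \<in> heights s" "\<forall>x\<in>X. p dvd below X x" by blast
    obtain la where la: "is_partition la" "beta_set la = X"
      using beta_set_surj[OF finite_beads[OF s] zero_notin_beads[OF s h(2)]] h(1) by metis
    have "x - s \<in> X" if "x \<in> X" "s \<le> x" for x
      using beads_closed_diff[OF s h(2)] that h(1) by blast
    moreover have "x - (s + 1) \<in> X" if "x \<in> X" "s + 1 \<le> x" for x
      using beads_closed(2)[OF s h(2), of "x - (s + 1)"] that h(1) by simp
    ultimately have "is_core s la" "is_core (s + 1) la"
      using is_core_iff[OF la(1)] s la(2) by auto
    moreover have "\<forall>x\<in>set la. p dvd x" using la(2) dvd[OF la(1)] h(3) by simp
    ultimately show "X \<in> beta_set ` ?P" using la by (intro image_eqI[of _ _ la]) simp_all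
  qed
  moreover have "inj_on beta_set ?P" by (rule inj_on_subset[OF beta_set_inj]) blast
  moreover have "inj_on (beads s) ?H" by (rule inj_on_subset[OF beads_inj[OF s]]) blast
  ultimately show ?thesis using card_image[of beta_set ?P] card_image[of "beads s" ?H] by argo
qed

theorem theorem3p1:
  fixes s p k r :: nat
  assumes "0 < s" and "0 < p" and "s = k * p + r" and "r < p"
  shows "real (card {la. is_partition la \<and> is_core s la \<and> is_core (s + 1) la
                        \<and> (\<forall>x\<in>set la. p dvd x)}) = raney (p + 1) (r + 1) k
       \<and> raney (p + 1) (r + 1) k
           = real (s + 1 - p * (s div p)) / real (s + 1) * real ((s + s div p) choose s)"
proof -
  have k: "s div p = k" and r: "s + 1 - p * k = r + 1"
    using assms by (simp_all add: mult.commute)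
  show ?thesis
    unfolding k r card_core_partitions[OF assms(1)] card_heights_dvd_below[OF assms]
    using card_ballot_eq_raney[OF assms(2,3)] by blast
qed

end
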